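(* Let $s\ge 2$ and $r>1$ be integers, and let $H_{r,s}$ be the largest value obtained in $r$ rolls of a fair $s$-sided die. Then $$E[H_{r,s}]=s-\frac{\sum_{i=1}^{s-1}i^r}{s^r}.$$
   Context: A fair $s$-sided die takes each value in $\{1,\dots,s\}$ with equal probability. An advantage experiment consists of rolling the die $r$ times (independently, so that all $s^r$ sequences in $\{1,\dots,s\}^r$ are equally likely) and taking the largest number rolled as the outcome. $H_{r,s}$ is the random variable giving this outcome, i.e. $H_{r,s}=\max(X_1,\dots,X_r)$ with $X_1,\dots,X_r$ independent and uniform on $\{1,\dots,s\}$. *)

theory Defs
  imports "HOL-Probability.Probability"
begin

definition fair_die :: "nat \<Rightarrow> nat pmf" where
  "fair_die s = pmf_of_set {1..s}"

(* The rolls X 1, ..., X r live on an arbitrary probability space M.  The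
   library's indep_vars includes the measurability of each X i, and the second
   conjunct says that X i has the law of one fair die; as usual for random
   variables, values outside {1..s} are possible on a null set. *)
definition fair_die_rolls :: "'a measure \<Rightarrow> nat \<Rightarrow> nat \<Rightarrow> (nat \<Rightarrow> 'a \<Rightarrow> nat) \<Rightarrow> bool" where
  "fair_die_rolls M r s X \<longleftrightarrow>
     prob_space.indep_vars M (\<lambda>_. count_space UNIV) X {1..r} \<and>
     (\<forall>i\<in>{1..r}. distr M (count_space UNIV) (X i) = measure_pmf (fair_die s))"

definition highest_roll :: "nat \<Rightarrow> (nat \<Rightarrow> 'a \<Rightarrow> nat) \<Rightarrow> 'a \<Rightarrow> nat" where
  "highest_roll r X \<omega> = Max ((\<lambda>i. X i \<omega>) ` {1..r})"

end

theory Submission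
  imports Defs
begin

text \<open>On \<open>1 \<le> H \<le> s\<close> one has \<open>H = s - card {i \<in> {1..s-1}. H \<le> i}\<close>. Taking expectations
  leaves the distribution function of \<open>H\<close>, which by independence is the \<open>r\<close>-th power \<open>(i / s)\<^sup>r\<close>
  of that of a single roll.\<close>

lemma real_eq_diff_sum_indicator:
  fixes n s :: nat
  assumes "n \<in> {1..s}"
  shows "real n = real s - (\<Sum>i=1..s-1. indicator {..i} n)"
proof -
  have "(\<Sum>i=1..s-1. indicator {..i} n :: real) = (\<Sum>i\<in>{1..s-1} \<inter> {i. n \<le> i}. 1)"
    by (simp add: sum.inter_restrict indicator_def)
  \<comment> \<open>The bound \<open>1 \<le> n\<close> keeps the whole interval inside
    \<open>{1..s-1}\<close>. It has \<open>s - n\<close> elements and is empty for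
    \<open>n = s\<close>.\<close>
  also have "{1..s-1} \<inter> {i. n \<le> i} = {n..s-1}"
    using assms by auto
  finally show ?thesis
    using assms by simp
qed

lemma highest_roll_le_iff:
  assumes "r > 0"
  shows "highest_roll r X \<omega> \<le> k \<longleftrightarrow> (\<forall>i\<in>{1..r}. X i \<omega> \<le> k)"
  unfolding highest_roll_def using assms by (subst Max_le_iff) auto

text \<open>A maximum over a nonempty finite set is attained, so it is itself one of the rolls. This
  carries the range of the single rolls over to the highest one.\<close>

lemma highest_roll_mem:
  assumes "r > 0" and "\<And>i. i \<in> {1..r} \<Longrightarrow> X i \<omega> \<in> A"
  shows "highest_roll r X \<omega> \<in> A"
proof -
  have "highest_roll r X \<omega> \<in> (\<lambda>i. X i \<omega>) ` {1..r}"
    unfolding highest_roll_def using assms(1) by (intro Max_in) auto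
  then show ?thesis
    using assms(2) by auto
qed

context prob_space
begin

lemma fair_die_rolls_measurable:
  assumes "fair_die_rolls M r s X" and "i \<in> {1..r}"
  shows "X i \<in> measurable M (count_space UNIV)"
  using assms unfolding fair_die_rolls_def indep_vars_def by auto

lemma prob_fair_die_roll:
  assumes X: "fair_die_rolls M r s X" "i \<in> {1..r}"
  shows "prob (X i -` A \<inter> space M) = measure_pmf.prob (fair_die s) A"
proof -
  have "prob (X i -` A \<inter> space M) = measure (distr M (count_space UNIV) (X i)) A"
    using fair_die_rolls_measurable[OF X] by (subst measure_distr) auto
  then show ?thesis
    using X by (simp add: fair_die_rolls_def)
qed

lemma AE_fair_die_roll:
  assumes X: "fair_die_rolls M r s X" "i \<in> {1..r}" and "s > 0"
  shows "AE \<omega> in M. X i \<omega> \<in> {1..s}"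
proof -
  have distr: "distr M (count_space UNIV) (X i) = measure_pmf (fair_die s)"
    using X by (simp add: fair_die_rolls_def)
  have "AE n in distr M (count_space UNIV) (X i). n \<in> {1..s}"
    \<comment> \<open>Almost surely under a pmf means everywhere on its support, which is
      \<open>{1..s}\<close> because this set is finite and, by \<open>s > 0\<close>,
      nonempty.\<close>
    unfolding distr AE_measure_pmf_iff using \<open>s > 0\<close> by (simp add: fair_die_def)
  then show ?thesis
    using fair_die_rolls_measurable[OF X] by (subst (asm) AE_distr_iff) auto
qed

lemma AE_highest_roll:
  assumes "fair_die_rolls M r s X" and "r > 0" and "s > 0"
  shows "AE \<omega> in M. highest_roll r X \<omega> \<in> {1..s}"
proof -
  have "AE \<omega> in M. \<forall>i\<in>{1..r}. X i \<omega> \<in> {1..s}"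
    using AE_fair_die_roll assms by (intro AE_finite_allI) auto
  then show ?thesis
    by (rule AE_mp) (auto intro!: AE_I2 highest_roll_mem[OF \<open>r > 0\<close>] simp del: atLeastAtMost_iff)
qed

lemma highest_roll_measurable:
  assumes "fair_die_rolls M r s X" and "r > 0"
  shows "highest_roll r X \<in> measurable M (count_space UNIV)"
proof -
  \<comment> \<open>The Borel sigma-algebra on the naturals is discrete, so Borel measurability of
    finite maxima can be used.\<close>
  have borel: "measurable M (count_space UNIV) = (borel_measurable M :: ('a \<Rightarrow> nat) set)"
    by (intro measurable_cong_sets) (simp_all add: sets_borel_eq_count_space)
  show ?thesis
    unfolding borel highest_roll_def[abs_def]
    using fair_die_rolls_measurable[OF assms(1)] by (intro borel_measurable_Max) (auto simp: borel)
qed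

lemma prob_highest_roll_le:
  assumes X: "fair_die_rolls M r s X" and "r > 0" and "s > 0" and "k \<le> s"
  shows "prob (highest_roll r X -` {..k} \<inter> space M) = (real k / real s) ^ r"
proof -
  have die: "measure_pmf.prob (fair_die s) {..k} = real k / real s"
  proof -
    have "{1..s} \<inter> {..k} = {1..k}"
      using \<open>k \<le> s\<close> by auto
    then show ?thesis
      using \<open>s > 0\<close> \<open>k \<le> s\<close> by (simp add: fair_die_def measure_pmf_of_set)
  qed
  \<comment> \<open>The maximum is at most \<open>k\<close> exactly when every roll is; independence
    then factorizes the probability of this intersection.\<close>
  have eq: "highest_roll r X -` {..k} \<inter> space M = (\<Inter>i\<in>{1..r}. X i -` {..k} \<inter> space M)"
    using \<open>r > 0\<close> by (auto simp: highest_roll_le_iff)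
  have indep: "indep_vars (\<lambda>_. count_space UNIV) X {1..r}"
    using X by (simp add: fair_die_rolls_def)
  have "prob (\<Inter>i\<in>{1..r}. X i -` {..k} \<inter> space M) = (\<Prod>i\<in>{1..r}. prob (X i -` {..k} \<inter> space M))"
    using \<open>r > 0\<close> by (intro indep_varsD_finite[OF indep]) auto
  also have "\<dots> = (\<Prod>i\<in>{1..r}. real k / real s)"
    using prob_fair_die_roll[OF X] die by (intro prod.cong) auto
  finally show ?thesis
    by (simp add: eq)
qed

end

theorem theorem2p3:
  fixes M :: "'a measure" and X :: "nat \<Rightarrow> 'a \<Rightarrow> nat" and r s :: nat
  assumes "s \<ge> 2" and "r > 1"
    and "prob_space M"
    and "fair_die_rolls M r s X"
  shows "prob_space.expectation M (\<lambda>\<omega>. real (highest_roll r X \<omega>)) =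
           real s - (\<Sum>i=1..s-1. real i ^ r) / real s ^ r"
proof -
  interpret prob_space M by fact
  have "r > 0" "s > 0"
    using assms by auto
  note X = assms(4)
  note [measurable] = highest_roll_measurable[OF X \<open>r > 0\<close>]
  define E where "E i = highest_roll r X -` {..i} \<inter> space M" for i
  have E [measurable]: "E i \<in> events" for i
    unfolding E_def by measurable
  \<comment> \<open>On \<open>space M\<close>, the indicator of \<open>E i\<close> is that of
    \<open>{..i}\<close> evaluated at the highest roll.\<close>
  have eq: "real (highest_roll r X \<omega>) = real s - (\<Sum>i=1..s-1. indicator (E i) \<omega>)"
    if "highest_roll r X \<omega> \<in> {1..s}" "\<omega> \<in> space M" for \<omega>
    using real_eq_diff_sum_indicator[OF that(1)] that(2) by (simp add: E_def indicator_def)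
  \<comment> \<open>The pointwise identity may fail on the null set where some roll leaves
    \<open>{1..s}\<close>, so the integrands agree only almost everywhere.\<close>
  have "expectation (\<lambda>\<omega>. real (highest_roll r X \<omega>)) =
      expectation (\<lambda>\<omega>. real s - (\<Sum>i=1..s-1. indicator (E i) \<omega>))"
    using AE_highest_roll[OF X \<open>r > 0\<close> \<open>s > 0\<close>] eq by (intro integral_cong_AE) auto
  \<comment> \<open>Linearity of expectation: the constant keeps its value because the total mass is
    1, and each indicator integrates to the probability of its event.\<close>
  also have "\<dots> = real s - (\<Sum>i=1..s-1. prob (E i))"
    by (simp add: emeasure_eq_measure prob_space)
  also have "(\<Sum>i=1..s-1. prob (E i)) = (\<Sum>i=1..s-1. (real i / real s) ^ r)"
    unfolding E_def using prob_highest_roll_le[OF X \<open>r > 0\<close> \<open>s > 0\<close>] by (intro sum.cong) auto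
  finally show ?thesis
    by (simp add: power_divide sum_divide_distrib)
qed

end
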